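(* Let $\mu$ be a quasi-definite complex Borel measure on the unit circle $\mathbb T$, and let $\{\varphi_1^{(l)}\}_{l\ge 0}$, $\{\varphi_2^{(l)}\}_{l\ge 0}$ be the two sequences of Laurent polynomials obtained from the $LU$ factorization $g=S_1^{-1}S_2$ of the CMV moment matrix of $\mu$, i.e. $\varphi_1^{(l)}=(S_1\chi)^{(l)}$ and $\varphi_2^{(l)}=((S_2^{-1})^\dagger\chi)^{(l)}$. Then these sequences are bi-orthogonal with respect to $\mu$: $$\oint_{\mathbb T}\varphi_1^{(l)}(z)\,\bar\varphi_2^{(k)}(z^{-1})\,d\mu(z)=\delta_{l,k},\qquad l,k=0,1,2,\dots$$
   Context: $\mathbb T=\{z\in\mathbb C:|z|=1\}$; $\oint_{\mathbb T}f(z)\,d\mu(z)$ is the integral of $f$ against $\mu$. The measure $\mu$ is quasi-definite if all Toeplitz matrices $\big(\oint_{\mathbb T}z^{i-j}d\mu\big)_{i,j=0}^n$, $n\ge0$, are non-singular. All semi-infinite matrices and vectors are indexed by $0,1,2,\dots$; $\dagger$ is the conjugate transpose. CMV ordering: $\chi(z)=(1,z^{-1},z,z^{-2},z^2,\dots)^\top$, i.e. $\chi^{(2k)}=z^k$, $\chi^{(2k+1)}=z^{-k-1}$. CMV moment matrix: $g=\oint_{\mathbb T}\chi(z)\chi(z)^\dagger d\mu(z)$. Quasi-definiteness is equivalent to non-vanishing of all leading principal minors of $g$, so there is a unique factorization $g=S_1^{-1}S_2$ with $S_1$ lower triangular with ones on the diagonal and $S_2$ upper triangular with non-zero diagonal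 entries. For a Laurent polynomial $f(z)=\sum_k f_kz^k$, $\bar f(z):=\sum_k\overline{f_k}z^k$ (so $\bar f(z^{-1})=\overline{f(z)}$ on $\mathbb T$). *)

theory Defs
  imports
    "HOL-Analysis.Analysis"
    "HOL-Library.Poly_Mapping"
    "Jordan_Normal_Form.Determinant"
begin

section \<open>Complex measures\<close>

text \<open>
  A complex measure is a countably additive complex set function \<open>\<nu>\<close> on the sigma-algebra
  \<open>sets M\<close>; only \<open>space M\<close> and \<open>sets M\<close> are used, and the values of \<open>\<nu>\<close> outside \<open>sets M\<close> are
  irrelevant.
\<close>

definition complex_measure :: "'a measure \<Rightarrow> ('a set \<Rightarrow> complex) \<Rightarrow> bool" where
  "complex_measure M \<nu> \<longleftrightarrow>
     \<nu> {} = 0 \<and>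
     (\<forall>A. range A \<subseteq> sets M \<longrightarrow> disjoint_family A \<longrightarrow>
        (\<lambda>i::nat. \<nu> (A i)) sums \<nu> (\<Union>i. A i))"

text \<open>
  The positive part of the Jordan decomposition of a real signed measure \<open>\<rho>\<close>, in the form
  \<open>\<rho>\<^sup>+ A = sup {\<rho> B | B \<subseteq> A measurable}\<close>. As \<open>\<rho> {} = 0\<close>, the truncation of negative values
  by \<^const>\<open>ennreal\<close> does not affect the supremum. The negative part is the positive part of
  \<open>-\<rho>\<close>.
\<close>

definition positive_variation :: "'a measure \<Rightarrow> ('a set \<Rightarrow> real) \<Rightarrow> 'a measure" where
  "positive_variation M \<rho> =
     measure_of (space M) (sets M) (\<lambda>A. SUP B\<in>{B \<in> sets M. B \<subseteq> A}. ennreal (\<rho> B))"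

definition signed_integral :: "'a measure \<Rightarrow> ('a set \<Rightarrow> real) \<Rightarrow> ('a \<Rightarrow> complex) \<Rightarrow> complex" where
  "signed_integral M \<rho> f =
     integral\<^sup>L (positive_variation M \<rho>) f - integral\<^sup>L (positive_variation M (\<lambda>A. - \<rho> A)) f"

definition complex_integral :: "'a measure \<Rightarrow> ('a set \<Rightarrow> complex) \<Rightarrow> ('a \<Rightarrow> complex) \<Rightarrow> complex" where
  "complex_integral M \<nu> f =
     signed_integral M (\<lambda>A. Re (\<nu> A)) f + \<i> * signed_integral M (\<lambda>A. Im (\<nu> A)) f"

definition borel_circle :: "complex measure" where
  "borel_circle = restrict_space borel (sphere 0 1)"

abbreviation circle_integral :: "(complex set \<Rightarrow> complex) \<Rightarrow> (complex \<Rightarrow> complex) \<Rightarrow> complex" where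
  "circle_integral \<mu> \<equiv> complex_integral borel_circle \<mu>"

definition quasi_definite :: "(complex set \<Rightarrow> complex) \<Rightarrow> bool" where
  "quasi_definite \<mu> \<longleftrightarrow>
     (\<forall>n::nat. Determinant.det
        (Matrix.mat (n + 1) (n + 1)
           (\<lambda>(i, j). circle_integral \<mu> (\<lambda>z. z powi (int i - int j)))) \<noteq> 0)"

section \<open>Laurent polynomials\<close>

text \<open>The coefficient of \<open>z\<^sup>k\<close> in \<open>f\<close> is \<open>Poly_Mapping.lookup f k\<close>.\<close>

type_synonym laurent_poly = "int \<Rightarrow>\<^sub>0 complex"

definition laurent_eval :: "laurent_poly \<Rightarrow> complex \<Rightarrow> complex" where
  "laurent_eval f z = (\<Sum>k\<in>Poly_Mapping.keys f. Poly_Mapping.lookup f k * z powi k)"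

definition laurent_bar :: "laurent_poly \<Rightarrow> laurent_poly" where
  "laurent_bar f = Poly_Mapping.map cnj f"

definition cmv_exponent :: "nat \<Rightarrow> int" where
  "cmv_exponent l = (if even l then int (l div 2) else - int (l div 2) - 1)"

definition cmv_chi :: "nat \<Rightarrow> laurent_poly" where
  "cmv_chi l = Poly_Mapping.single (cmv_exponent l) 1"

section \<open>Semi-infinite matrices\<close>

text \<open>
  \<^const>\<open>Sum_any\<close> is the sum over the support of a function. In every product and inverse used
  below one factor is triangular on the appropriate side, so that these sums are finite.
\<close>

type_synonym semi_matrix = "nat \<Rightarrow> nat \<Rightarrow> complex"

definition semi_mult :: "semi_matrix \<Rightarrow> semi_matrix \<Rightarrow> semi_matrix" where
  "semi_mult A B = (\<lambda>i j. Sum_any (\<lambda>k. A i k * B k j))"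

definition semi_one :: semi_matrix where
  "semi_one = (\<lambda>i j. if i = j then 1 else 0)"

text \<open>
  For a triangular matrix with non-zero diagonal entries there is exactly one two-sided inverse,
  by forward or backward substitution, and it is triangular of the same kind.
\<close>

definition semi_inverse :: "semi_matrix \<Rightarrow> semi_matrix" where
  "semi_inverse A = (THE B. semi_mult A B = semi_one \<and> semi_mult B A = semi_one)"

definition semi_adjoint :: "semi_matrix \<Rightarrow> semi_matrix" where
  "semi_adjoint A = (\<lambda>i j. cnj (A j i))"

definition unit_lower_triangular :: "semi_matrix \<Rightarrow> bool" where
  "unit_lower_triangular A \<longleftrightarrow> (\<forall>i. A i i = 1) \<and> (\<forall>i j. i < j \<longrightarrow> A i j = 0)"

definition nonsingular_upper_triangular :: "semi_matrix \<Rightarrow> bool" where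
  "nonsingular_upper_triangular A \<longleftrightarrow> (\<forall>i. A i i \<noteq> 0) \<and> (\<forall>i j. j < i \<longrightarrow> A i j = 0)"

text \<open>The \<open>l\<close>-th entry of \<open>A \<chi>\<close>; multiplication by \<open>single 0 c\<close> is multiplication by the scalar \<open>c\<close>.\<close>

definition apply_chi :: "semi_matrix \<Rightarrow> nat \<Rightarrow> laurent_poly" where
  "apply_chi A l = Sum_any (\<lambda>k. Poly_Mapping.single 0 (A l k) * cmv_chi k)"

section \<open>The CMV moment matrix and its factorization\<close>

definition cmv_moment :: "(complex set \<Rightarrow> complex) \<Rightarrow> semi_matrix" where
  "cmv_moment \<mu> =
     (\<lambda>i j. circle_integral \<mu> (\<lambda>z. laurent_eval (cmv_chi i) z * cnj (laurent_eval (cmv_chi j) z)))"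

definition is_LU :: "semi_matrix \<Rightarrow> semi_matrix \<Rightarrow> semi_matrix \<Rightarrow> bool" where
  "is_LU g S1 S2 \<longleftrightarrow>
     unit_lower_triangular S1 \<and> nonsingular_upper_triangular S2 \<and>
     g = semi_mult (semi_inverse S1) S2"

text \<open>For the moment matrix of a quasi-definite measure the factorization exists and is unique.\<close>

definition cmv_S1 :: "(complex set \<Rightarrow> complex) \<Rightarrow> semi_matrix" where
  "cmv_S1 \<mu> = (THE S1. \<exists>S2. is_LU (cmv_moment \<mu>) S1 S2)"

definition cmv_S2 :: "(complex set \<Rightarrow> complex) \<Rightarrow> semi_matrix" where
  "cmv_S2 \<mu> = (THE S2. \<exists>S1. is_LU (cmv_moment \<mu>) S1 S2)"

definition cmv_phi1 :: "(complex set \<Rightarrow> complex) \<Rightarrow> nat \<Rightarrow> laurent_poly" where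
  "cmv_phi1 \<mu> = apply_chi (cmv_S1 \<mu>)"

definition cmv_phi2 :: "(complex set \<Rightarrow> complex) \<Rightarrow> nat \<Rightarrow> laurent_poly" where
  "cmv_phi2 \<mu> = apply_chi (semi_adjoint (semi_inverse (cmv_S2 \<mu>)))"

end

theory Submission
  imports Defs
begin

text \<open>
  On the circle \<open>bar \<phi>\<^sub>2 (z\<inverse>)\<close> is the complex conjugate of \<open>\<phi>\<^sub>2 z\<close>. Both Laurent polynomials are
  finite combinations of the entries of \<open>\<chi>\<close>, whose coefficients are row \<open>l\<close> of \<open>S\<^sub>1\<close> and the
  conjugate of column \<open>k\<close> of \<open>S\<^sub>2\<inverse>\<close>. Expanding the product therefore gives
  \<open>\<Sum>i\<le>l. \<Sum>j\<le>k. S\<^sub>1 l i * g i j * S\<^sub>2\<inverse> j k\<close>, the \<open>(l, k)\<close> entry of \<open>S\<^sub>1 g S\<^sub>2\<inverse>\<close>. As \<open>S\<^sub>1 g = S\<^sub>2\<close>,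
  this is the entry of the identity matrix.

  Three facts make this computation legitimate.

  The integral is linear on Laurent polynomials (\<open>complex_integral_linear\<close>). The integral is built
  from the variations of the real and imaginary parts of the measure, so bounded functions must be
  shown integrable for them. This rests on the classical fact that a complex measure has bounded
  range (\<open>complex_measure_bounded\<close>).

  Triangular matrices with non-zero diagonal have unique inverses, and products whose left factors
  are lower triangular associate, because only finite sums occur (\<open>semi_mult_assoc_lower\<close>,
  \<open>semi_inverse_lower\<close>,
  \<open>semi_inverse_upper\<close>).

  The factors \<open>S\<^sub>1\<close> and \<open>S\<^sub>2\<close> really factor \<open>g\<close> (\<open>is_LU_cmv\<close>). The equation \<open>g = S\<^sub>1\<inverse> S\<^sub>2\<close> says
  that \<open>S\<^sub>1 g\<close> is upper triangular, which for each row of \<open>S\<^sub>1\<close> is a linear system whose matrix is a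
  leading block of \<open>g\<close>. The first \<open>n\<close> exponents of the CMV ordering are \<open>n\<close> consecutive integers, so
  this block is a Toeplitz matrix with rows and columns permuted in the same way, and it is
  invertible by quasi-definiteness (\<open>cmv_blocks_invertible\<close>).
\<close>

section \<open>Integration against a complex measure\<close>

lemma complex_measure_empty:
  assumes "complex_measure M \<nu>"
  shows "\<nu> {} = 0"
  using assms by (simp add: complex_measure_def)

lemma complex_measure_Un:
  assumes "complex_measure M \<nu>" "A \<in> sets M" "B \<in> sets M" "A \<inter> B = {}"
  shows "\<nu> (A \<union> B) = \<nu> A + \<nu> B"
proof -
  have "range (binaryset A B) \<subseteq> sets M"
    using assms(2,3) by (auto simp: range_binaryset_eq)
  moreover have "disjoint_family (binaryset A B)"
    using assms(4) by (auto simp: disjoint_family_on_def binaryset_def)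
  ultimately have "(\<lambda>i. \<nu> (binaryset A B i)) sums \<nu> (\<Union>i. binaryset A B i)"
    using assms(1) unfolding complex_measure_def by blast
  moreover have "(\<lambda>i. \<nu> (binaryset A B i)) sums (\<nu> A + \<nu> B)"
    using binaryset_sums[of \<nu> A B] complex_measure_empty[OF assms(1)] by simp
  ultimately show ?thesis
    by (simp add: sums_unique2 UN_binaryset_eq)
qed

lemma complex_measure_Diff:
  assumes "complex_measure M \<nu>" "A \<in> sets M" "B \<in> sets M" "B \<subseteq> A"
  shows "\<nu> A = \<nu> B + \<nu> (A - B)"
  using complex_measure_Un[OF assms(1), of B "A - B"] assms
  by (metis Diff_disjoint Diff_partition sets.Diff)

definition unbounded_on :: "'a measure \<Rightarrow> ('a set \<Rightarrow> complex) \<Rightarrow> 'a set \<Rightarrow> bool" where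
  "unbounded_on M \<nu> E \<longleftrightarrow>
     E \<in> sets M \<and> (\<forall>C::real. \<exists>B\<in>sets M. B \<subseteq> E \<and> norm (\<nu> B) > C)"

text \<open>
  Choose \<open>B \<subseteq> E\<close> with \<open>|\<nu> B| > |\<nu> E| + 1\<close>. Then \<open>B\<close> and \<open>E - B\<close> both have measure larger than 1 in
  modulus, and \<open>\<nu>\<close> is unbounded on at least one of them. That one is \<open>E'\<close>.
\<close>

lemma unbounded_split:
  assumes \<nu>: "complex_measure M \<nu>" and E: "unbounded_on M \<nu> E"
  shows "\<exists>E'. unbounded_on M \<nu> E' \<and> E' \<subseteq> E \<and> norm (\<nu> (E - E')) > 1"
proof -
  have Es: "E \<in> sets M" using E by (simp add: unbounded_on_def)
  obtain B where B: "B \<in> sets M" "B \<subseteq> E" "norm (\<nu> B) > norm (\<nu> E) + 1"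
    using E unfolding unbounded_on_def by blast
  have "\<nu> E = \<nu> B + \<nu> (E - B)"
    using complex_measure_Diff[OF \<nu> Es B(1,2)] .
  hence D: "norm (\<nu> (E - B)) > 1"
    using B(3) norm_triangle_ineq4[of "\<nu> E" "\<nu> (E - B)"] by (simp add: algebra_simps)
  have B1: "norm (\<nu> B) > 1"
    using B(3) norm_ge_zero[of "\<nu> E"] by linarith
  have "unbounded_on M \<nu> B \<or> unbounded_on M \<nu> (E - B)"
  proof (rule ccontr)
    assume "\<not> ?thesis"
    then obtain C1 C2 where
      C: "\<And>X. X \<in> sets M \<Longrightarrow> X \<subseteq> B \<Longrightarrow> norm (\<nu> X) \<le> C1"
         "\<And>X. X \<in> sets M \<Longrightarrow> X \<subseteq> E - B \<Longrightarrow> norm (\<nu> X) \<le> C2"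
      using B(1) Es unfolding unbounded_on_def by (metis linorder_not_less sets.Diff)
    obtain X where X: "X \<in> sets M" "X \<subseteq> E" "norm (\<nu> X) > C1 + C2"
      using E unfolding unbounded_on_def by blast
    have "\<nu> X = \<nu> (X \<inter> B) + \<nu> (X - X \<inter> B)"
      using complex_measure_Diff[OF \<nu> X(1), of "X \<inter> B"] X B by auto
    moreover have "norm (\<nu> (X \<inter> B)) \<le> C1"
      using C(1)[of "X \<inter> B"] X B by auto
    moreover have "norm (\<nu> (X - X \<inter> B)) \<le> C2"
      using C(2)[of "X - X \<inter> B"] X B by auto
    ultimately show False
      using X(3) norm_triangle_ineq[of "\<nu> (X \<inter> B)" "\<nu> (X - X \<inter> B)"] by auto
  qed
  thus ?thesis
  proof
    assume "unbounded_on M \<nu> B"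
    thus ?thesis using B D by blast
  next
    assume "unbounded_on M \<nu> (E - B)"
    moreover have "E - (E - B) = B" using B by blast
    ultimately show ?thesis using B1 by (metis Diff_subset)
  qed
qed

text \<open>
  If \<open>\<nu>\<close> were unbounded, splitting repeatedly would give a decreasing sequence of sets whose
  successive differences are disjoint and have measure larger than 1 in modulus, although the series
  of their measures converges.
\<close>

lemma complex_measure_bounded:
  assumes \<nu>: "complex_measure M \<nu>"
  obtains C where "\<And>B. B \<in> sets M \<Longrightarrow> norm (\<nu> B) \<le> C"
proof -
  have "\<not> unbounded_on M \<nu> (space M)"
  proof
    assume U: "unbounded_on M \<nu> (space M)"
    define next_set where "next_set =
      (\<lambda>E. SOME E'. unbounded_on M \<nu> E' \<and> E' \<subseteq> E \<and> norm (\<nu> (E - E')) > 1)"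
    have step: "unbounded_on M \<nu> (next_set E) \<and> next_set E \<subseteq> E \<and>
        norm (\<nu> (E - next_set E)) > 1"
      if "unbounded_on M \<nu> E" for E
      unfolding next_set_def using someI_ex[OF unbounded_split[OF \<nu> that]] .
    define F where "F = (\<lambda>n. (next_set ^^ n) (space M))"
    have FS: "F (Suc n) = next_set (F n)" for n by (simp add: F_def)
    have FU: "unbounded_on M \<nu> (F n)" for n
      by (induction n) (use U step in \<open>auto simp: F_def\<close>)
    have dec: "decseq F"
      by (rule decseq_SucI) (use step[OF FU] FS in auto)
    define A where "A = (\<lambda>n. F n - F (Suc n))"
    have "disjoint_family A"
    proof -
      have "A m \<inter> A n = {}" if "m < n" for m n
      proof -
        have "F n \<subseteq> F (Suc m)" using dec that by (simp add: decseq_def)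
        thus ?thesis by (auto simp: A_def)
      qed
      thus ?thesis
        unfolding disjoint_family_on_def by (metis Int_commute linorder_neqE_nat)
    qed
    moreover have "range A \<subseteq> sets M"
      using FU by (auto simp: A_def unbounded_on_def)
    ultimately have "summable (\<lambda>i. \<nu> (A i))"
      using \<nu> unfolding complex_measure_def by (meson sums_summable)
    hence "(\<lambda>i. norm (\<nu> (A i))) \<longlonglongrightarrow> 0"
      using summable_LIMSEQ_zero tendsto_norm_zero by blast
    hence "eventually (\<lambda>i. norm (\<nu> (A i)) < 1) sequentially"
      by (rule order_tendstoD) simp
    then obtain i where "norm (\<nu> (A i)) < 1"
      by (auto simp: eventually_sequentially)
    moreover have "norm (\<nu> (A i)) > 1"
      using step[OF FU[of i]] by (simp add: A_def FS)
    ultimately show False by simp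
  qed
  then obtain C where "\<And>B. B \<in> sets M \<Longrightarrow> norm (\<nu> B) \<le> C"
    unfolding unbounded_on_def
    by (metis linorder_not_less sets.sets_into_space sets.top)
  thus thesis by (rule that)
qed

lemma sets_positive_variation [simp, measurable_cong]:
  "sets (positive_variation M \<rho>) = sets M"
  by (simp add: positive_variation_def)

lemma space_positive_variation [simp]:
  "space (positive_variation M \<rho>) = space M"
  by (simp add: positive_variation_def)

text \<open>
  The total mass is the supremum in the definition or, should that set function fail to be countably
  additive, the default value 0 of \<^const>\<open>measure_of\<close>. It is finite in both cases.
\<close>

lemma finite_positive_variation:
  assumes "\<And>B. B \<in> sets M \<Longrightarrow> \<rho> B \<le> C"
  shows "finite_measure (positive_variation M \<rho>)"
proof (rule finite_measureI)
  have "(SUP B\<in>{B \<in> sets M. B \<subseteq> space M}. ennreal (\<rho> B)) \<le> ennreal C"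
    using assms by (intro SUP_least) (auto intro: ennreal_leI)
  hence "(SUP B\<in>{B \<in> sets M. B \<subseteq> space M}. ennreal (\<rho> B)) \<noteq> \<infinity>"
    by (metis ennreal_less_top infinity_ennreal_def linorder_not_less)
  moreover have "emeasure (positive_variation M \<rho>) (space M) \<in>
      {0, SUP B\<in>{B \<in> sets M. B \<subseteq> space M}. ennreal (\<rho> B)}"
    unfolding positive_variation_def emeasure_measure_of_conv
    by (simp only: insert_iff split: if_split) blast
  ultimately show "emeasure (positive_variation M \<rho>) (space (positive_variation M \<rho>)) \<noteq> \<infinity>"
    unfolding space_positive_variation by (metis infinity_ennreal_def insertE singletonD ennreal_zero_neq_top)
qed

lemma complex_integral_cong:
  assumes "\<And>x. x \<in> space M \<Longrightarrow> f x = h x"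
  shows "complex_integral M \<nu> f = complex_integral M \<nu> h"
  unfolding complex_integral_def signed_integral_def
  by (intro arg_cong2[where f = "(+)"] arg_cong2[where f = "(-)"] arg_cong2[where f = "(*)"] refl
      Bochner_Integration.integral_cong) (simp_all add: assms)

lemma signed_integral_linear:
  assumes fin: "finite_measure (positive_variation M \<rho>)"
      "finite_measure (positive_variation M (\<lambda>A. - \<rho> A))"
    and meas: "\<And>i. i \<in> I \<Longrightarrow> f i \<in> borel_measurable M"
    and bdd: "\<And>i x. i \<in> I \<Longrightarrow> x \<in> space M \<Longrightarrow> norm (f i x) \<le> K"
  shows "signed_integral M \<rho> (\<lambda>x. \<Sum>i\<in>I. c i * f i x) = (\<Sum>i\<in>I. c i * signed_integral M \<rho> (f i))"
proof -
  have int: "integrable (positive_variation M \<rho>') (f i)"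
    if "finite_measure (positive_variation M \<rho>')" "i \<in> I" for \<rho>' i
  proof (rule finite_measure.integrable_const_bound[OF that(1)])
    show "AE x in positive_variation M \<rho>'. norm (f i x) \<le> K"
      using bdd[OF that(2)] by (intro AE_I2) simp
    show "f i \<in> borel_measurable (positive_variation M \<rho>')"
      using meas[OF that(2)] by simp
  qed
  show ?thesis
    unfolding signed_integral_def
    by (subst (1 2) Bochner_Integration.integral_sum)
       (auto simp: int fin sum_subtractf right_diff_distrib)
qed

lemma complex_integral_linear:
  assumes \<nu>: "complex_measure M \<nu>"
    and meas: "\<And>i. i \<in> I \<Longrightarrow> f i \<in> borel_measurable M"
    and bdd: "\<And>i x. i \<in> I \<Longrightarrow> x \<in> space M \<Longrightarrow> norm (f i x) \<le> K"
  shows "complex_integral M \<nu> (\<lambda>x. \<Sum>i\<in>I. c i * f i x) = (\<Sum>i\<in>I. c i * complex_integral M \<nu> (f i))"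
proof -
  obtain C where C: "\<And>B. B \<in> sets M \<Longrightarrow> norm (\<nu> B) \<le> C"
    using complex_measure_bounded[OF \<nu>] by blast
  have "\<bar>Re (\<nu> B)\<bar> \<le> C" "\<bar>Im (\<nu> B)\<bar> \<le> C" if "B \<in> sets M" for B
    using C[OF that] abs_Re_le_cmod abs_Im_le_cmod order_trans by blast+
  hence fin: "finite_measure (positive_variation M (\<lambda>A. Re (\<nu> A)))"
       "finite_measure (positive_variation M (\<lambda>A. - Re (\<nu> A)))"
       "finite_measure (positive_variation M (\<lambda>A. Im (\<nu> A)))"
       "finite_measure (positive_variation M (\<lambda>A. - Im (\<nu> A)))"
    by (intro finite_positive_variation[of _ _ C]; fastforce simp: abs_le_iff)+
  have "signed_integral M (\<lambda>A. Re (\<nu> A)) (\<lambda>x. \<Sum>i\<in>I. c i * f i x) =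
          (\<Sum>i\<in>I. c i * signed_integral M (\<lambda>A. Re (\<nu> A)) (f i))"
    by (rule signed_integral_linear[where K = K]) (use fin meas bdd in auto)
  moreover have "signed_integral M (\<lambda>A. Im (\<nu> A)) (\<lambda>x. \<Sum>i\<in>I. c i * f i x) =
          (\<Sum>i\<in>I. c i * signed_integral M (\<lambda>A. Im (\<nu> A)) (f i))"
    by (rule signed_integral_linear[where K = K]) (use fin meas bdd in auto)
  ultimately show ?thesis
    unfolding complex_integral_def
    by (simp add: sum.distrib sum_distrib_left distrib_left mult.left_commute)
qed

section \<open>Triangular semi-infinite matrices\<close>

definition lower_triangular :: "semi_matrix \<Rightarrow> bool" where
  "lower_triangular A \<longleftrightarrow> (\<forall>i j. i < j \<longrightarrow> A i j = 0)"

lemma semi_mult_finite: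
  assumes "finite K" "\<And>k. k \<notin> K \<Longrightarrow> A i k * B k j = 0"
  shows "semi_mult A B i j = (\<Sum>k\<in>K. A i k * B k j)"
  unfolding semi_mult_def
  by (rule Sum_any.expand_superset) (use assms in auto)

lemma semi_mult_lower:
  assumes "lower_triangular A"
  shows "semi_mult A B i j = (\<Sum>k\<le>i. A i k * B k j)"
  by (rule semi_mult_finite) (use assms in \<open>auto simp: lower_triangular_def\<close>)

lemma semi_mult_one_left [simp]: "semi_mult semi_one A = A"
proof (intro ext)
  show "semi_mult semi_one A i j = A i j" for i j
    by (subst semi_mult_finite[where K = "{i}"]) (auto simp: semi_one_def)
qed

lemma semi_mult_one_right [simp]: "semi_mult A semi_one = A"
proof (intro ext)
  show "semi_mult A semi_one i j = A i j" for i j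
    by (subst semi_mult_finite[where K = "{j}"]) (auto simp: semi_one_def)
qed

lemma semi_mult_transpose:
  "semi_mult (\<lambda>i j. A j i) (\<lambda>i j. B j i) = (\<lambda>i j. semi_mult B A j i)"
  by (simp add: semi_mult_def mult.commute)

lemma lower_triangular_mult:
  assumes "lower_triangular A" "lower_triangular B"
  shows "lower_triangular (semi_mult A B)"
  unfolding lower_triangular_def semi_mult_lower[OF assms(1)]
  using assms by (auto simp: lower_triangular_def intro!: sum.neutral)

text \<open>
  Infinite matrix products are not associative in general; lower triangularity of the two left
  factors makes every sum over the inner indices finite.
\<close>

lemma semi_mult_assoc_lower:
  assumes "lower_triangular A" "lower_triangular B"
  shows "semi_mult A (semi_mult B C) = semi_mult (semi_mult A B) C"
proof (intro ext)
  fix i j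
  have "semi_mult A (semi_mult B C) i j = (\<Sum>k\<le>i. A i k * (\<Sum>m\<le>k. B k m * C m j))"
    by (simp add: semi_mult_lower assms)
  also have "\<dots> = (\<Sum>k\<le>i. A i k * (\<Sum>m\<le>i. B k m * C m j))"
    by (intro sum.cong refl arg_cong2[where f = "(*)"] sum.mono_neutral_left)
       (use assms in \<open>auto simp: lower_triangular_def\<close>)
  also have "\<dots> = (\<Sum>m\<le>i. (\<Sum>k\<le>i. A i k * B k m) * C m j)"
    unfolding sum_distrib_left sum_distrib_right
    by (subst sum.swap) (simp add: mult.assoc)
  also have "\<dots> = semi_mult (semi_mult A B) C i j"
    by (simp add: semi_mult_lower assms lower_triangular_mult)
  finally show "semi_mult A (semi_mult B C) i j = semi_mult (semi_mult A B) C i j" .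
qed

text \<open>
  Column \<open>j\<close> of the inverse of a lower triangular matrix, as a function of the row index \<open>i\<close>.
\<close>

fun forward_subst :: "semi_matrix \<Rightarrow> nat \<Rightarrow> nat \<Rightarrow> complex" where
  "forward_subst A j i =
     ((if i = j then 1 else 0) - (\<Sum>k<i. A i k * forward_subst A j k)) / A i i"

declare forward_subst.simps [simp del]

lemma forward_subst_above: "i < j \<Longrightarrow> forward_subst A j i = 0"
proof (induction i rule: less_induct)
  case (less i)
  hence "(\<Sum>k<i. A i k * forward_subst A j k) = 0"
    by (intro sum.neutral) auto
  thus ?case
    using less.prems by (subst forward_subst.simps) simp
qed

lemma forward_subst_diag: "forward_subst A j j = 1 / A j j"
  by (subst forward_subst.simps) (simp add: forward_subst_above)

lemma lower_right_inverse:
  assumes "lower_triangular A" "\<And>i. A i i \<noteq> 0"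
  shows "\<exists>B. lower_triangular B \<and> (\<forall>i. B i i \<noteq> 0) \<and> semi_mult A B = semi_one"
proof (intro exI conjI allI ext)
  let ?B = "\<lambda>i j. forward_subst A j i"
  show "lower_triangular ?B"
    by (simp add: lower_triangular_def forward_subst_above)
  show "?B i i \<noteq> 0" for i
    using assms(2) by (simp add: forward_subst_diag)
  show "semi_mult A ?B i j = semi_one i j" for i j
  proof -
    have "A i i * ?B i j = semi_one i j - (\<Sum>k<i. A i k * ?B k j)"
      using assms(2)[of i] by (subst forward_subst.simps) (simp add: semi_one_def)
    moreover have "{..i} = insert i {..<i}" by auto
    ultimately show ?thesis
      by (simp add: semi_mult_lower assms(1))
  qed
qed

text \<open>
  The right inverse \<open>B\<close> of \<open>A\<close> is again lower triangular with non-zero diagonal, so it has a right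
  inverse \<open>C\<close> itself. Then \<open>A = A (B C) = (A B) C = C\<close>, so \<open>B A = 1\<close>.
\<close>

lemma lower_two_sided_inverse:
  assumes "lower_triangular A" "\<And>i. A i i \<noteq> 0"
  obtains B where "lower_triangular B" "semi_mult A B = semi_one" "semi_mult B A = semi_one"
proof -
  obtain B where B: "lower_triangular B" "\<And>i. B i i \<noteq> 0" "semi_mult A B = semi_one"
    using lower_right_inverse[OF assms] by blast
  obtain C where C: "semi_mult B C = semi_one"
    using lower_right_inverse[OF B(1,2)] by blast
  have "A = semi_mult A (semi_mult B C)"
    using C by simp
  also have "\<dots> = C"
    unfolding semi_mult_assoc_lower[OF assms(1) B(1)] B(3) by simp
  finally have "A = C" .
  thus thesis using that B C by blast
qed

text \<open>
  The matrices \<open>B\<close> and \<open>C\<close> are arbitrary, as \<^const>\<open>semi_inverse\<close> selects among all matrices and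
  not only among triangular ones.
\<close>

lemma lower_right_inverse_unique:
  assumes "lower_triangular A" "\<And>i. A i i \<noteq> 0"
    and "semi_mult A B = semi_one" "semi_mult A C = semi_one"
  shows "B = C"
proof -
  obtain D where "lower_triangular D" "semi_mult D A = semi_one"
    using lower_two_sided_inverse[OF assms(1,2)] by blast
  thus ?thesis
    using semi_mult_assoc_lower[of D A] assms by (metis semi_mult_one_left)
qed

lemma semi_inverse_lower:
  assumes "lower_triangular A" "\<And>i. A i i \<noteq> 0"
  shows "lower_triangular (semi_inverse A)" "semi_mult A (semi_inverse A) = semi_one"
    "semi_mult (semi_inverse A) A = semi_one"
proof -
  obtain B where B: "lower_triangular B" "semi_mult A B = semi_one" "semi_mult B A = semi_one"
    using lower_two_sided_inverse[OF assms] by blast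
  have "semi_inverse A = B"
    unfolding semi_inverse_def
    by (rule the_equality) (use B lower_right_inverse_unique[OF assms] in auto)
  thus "lower_triangular (semi_inverse A)" "semi_mult A (semi_inverse A) = semi_one"
    "semi_mult (semi_inverse A) A = semi_one" using B by simp_all
qed

text \<open>
  Transposition reverses products and maps upper to lower triangular matrices, so existence and
  uniqueness carry over from the lower triangular case.
\<close>

lemma semi_inverse_upper:
  assumes "nonsingular_upper_triangular A"
  shows "j < i \<Longrightarrow> semi_inverse A i j = 0" "semi_mult A (semi_inverse A) = semi_one"
proof -
  let ?T = "\<lambda>i j. A j i"
  have T: "lower_triangular ?T" "\<And>i. ?T i i \<noteq> 0"
    using assms by (auto simp: lower_triangular_def nonsingular_upper_triangular_def)
  have semi_one_sym: "semi_one i j = semi_one j i" for i j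
    by (simp add: semi_one_def)
  have one: "(\<lambda>i j. X j i) = semi_one \<longleftrightarrow> X = semi_one" for X :: semi_matrix
  proof
    assume eq: "(\<lambda>i j. X j i) = semi_one"
    show "X = semi_one"
    proof (intro ext)
      show "X i j = semi_one i j" for i j
        using fun_cong[OF fun_cong[OF eq, of j], of i] semi_one_sym by (rule trans)
    qed
  next
    assume eq: "X = semi_one"
    show "(\<lambda>i j. X j i) = semi_one"
      unfolding eq by (intro ext semi_one_sym)
  qed
  have flip: "semi_mult ?T (\<lambda>i j. C j i) = semi_one \<longleftrightarrow> semi_mult C A = semi_one"
     "semi_mult (\<lambda>i j. C j i) ?T = semi_one \<longleftrightarrow> semi_mult A C = semi_one" for C
    unfolding semi_mult_transpose[of A C] semi_mult_transpose[of C A] by (rule one)+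
  obtain B where B: "lower_triangular B" "semi_mult ?T B = semi_one" "semi_mult B ?T = semi_one"
    using lower_two_sided_inverse[OF T] by blast
  have "semi_inverse A = (\<lambda>i j. B j i)"
    unfolding semi_inverse_def
  proof (rule the_equality)
    show "semi_mult A (\<lambda>i j. B j i) = semi_one \<and> semi_mult (\<lambda>i j. B j i) A = semi_one"
      using B flip[of "\<lambda>i j. B j i"] by simp
  next
    fix C assume "semi_mult A C = semi_one \<and> semi_mult C A = semi_one"
    hence "(\<lambda>i j. C j i) = B"
      using lower_right_inverse_unique[OF T _ B(2)] flip by blast
    thus "C = (\<lambda>i j. B j i)" by auto
  qed
  thus "j < i \<Longrightarrow> semi_inverse A i j = 0" "semi_mult A (semi_inverse A) = semi_one"
    using B flip[of "\<lambda>i j. B j i"] by (auto simp: lower_triangular_def)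
qed

section \<open>The LU factorization\<close>

text \<open>
  The leading \<open>n \<times> n\<close> block of \<open>B\<close> is the two-sided inverse of that of \<open>A\<close>. Working with an inverse
  instead of a determinant turns the permutation of rows and columns into a reindexing of sums.
\<close>

definition block_inverse :: "nat \<Rightarrow> semi_matrix \<Rightarrow> semi_matrix \<Rightarrow> bool" where
  "block_inverse n A B \<longleftrightarrow>
     (\<forall>i<n. \<forall>j<n. (\<Sum>k<n. A i k * B k j) = semi_one i j) \<and>
     (\<forall>i<n. \<forall>j<n. (\<Sum>k<n. B i k * A k j) = semi_one i j)"

lemma block_left_kernel:
  assumes B: "block_inverse n A B" and v: "\<And>j. j < n \<Longrightarrow> (\<Sum>k<n. v k * A k j) = 0" and "i < n"
  shows "v i = 0"
proof -
  have "0 = (\<Sum>j<n. (\<Sum>k<n. v k * A k j) * B j i)"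
    using v by simp
  also have "\<dots> = (\<Sum>k<n. v k * (\<Sum>j<n. A k j * B j i))"
    unfolding sum_distrib_left sum_distrib_right by (subst sum.swap) (simp add: mult.assoc)
  also have "\<dots> = (\<Sum>k<n. v k * semi_one k i)"
    using B \<open>i < n\<close> by (intro sum.cong) (auto simp: block_inverse_def)
  also have "\<dots> = v i"
    using \<open>i < n\<close> by (simp add: semi_one_def if_distrib cong: if_cong)
  finally show ?thesis by simp
qed

lemma block_solve:
  assumes B: "block_inverse n A B"
  shows "\<exists>v. \<forall>j<n. (\<Sum>k<n. v k * A k j) = w j"
proof (intro exI allI impI)
  fix j assume j: "j < n"
  have "(\<Sum>k<n. (\<Sum>i<n. w i * B i k) * A k j) = (\<Sum>i<n. w i * (\<Sum>k<n. B i k * A k j))"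
    unfolding sum_distrib_left sum_distrib_right by (subst sum.swap) (simp add: mult.assoc)
  also have "\<dots> = (\<Sum>i<n. w i * semi_one i j)"
    using B j by (intro sum.cong) (auto simp: block_inverse_def)
  also have "\<dots> = w j"
    using j by (simp add: semi_one_def if_distrib cong: if_cong)
  finally show "(\<Sum>k<n. (\<Sum>i<n. w i * B i k) * A k j) = w j" .
qed

lemma block_inverse_reindex:
  assumes B: "block_inverse n A B" and p: "bij_betw p {..<n} {..<n}"
  shows "block_inverse n (\<lambda>i j. A (p i) (p j)) (\<lambda>i j. B (p i) (p j))"
proof -
  have re: "(\<Sum>k<n. C (p i) (p k) * D (p k) (p j)) = (\<Sum>k<n. C (p i) k * D k (p j))"
    for C D :: semi_matrix and i j
    using sum.reindex_bij_betw[OF p] .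
  have "p i < n" if "i < n" for i
    using p that by (auto simp: bij_betw_def)
  moreover have "semi_one (p i) (p j) = semi_one i j" if "i < n" "j < n" for i j
    using p that by (auto simp: bij_betw_def inj_on_def semi_one_def)
  ultimately show ?thesis
    using B unfolding block_inverse_def re by simp
qed

lemma det_nonzero_block_inverse:
  assumes "Determinant.det (Matrix.mat n n (\<lambda>(i, j). A i j)) \<noteq> 0"
  shows "\<exists>B. block_inverse n A B"
proof -
  let ?A = "Matrix.mat n n (\<lambda>(i, j). A i j)"
  have "?A \<in> Units (ring_mat TYPE(complex) n ())"
    by (rule det_non_zero_imp_unit[OF _ assms]) simp
  then obtain B where B: "B \<in> carrier_mat n n" "B * ?A = 1\<^sub>m n" "?A * B = 1\<^sub>m n"
    by (auto simp: Units_def ring_mat_def)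
  have "(\<Sum>k<n. A i k * B $$ (k, j)) = semi_one i j" if "i < n" "j < n" for i j
  proof -
    have "(?A * B) $$ (i, j) = (\<Sum>k<n. A i k * B $$ (k, j))"
      using that B(1) by (simp add: scalar_prod_def atLeast0LessThan)
    thus ?thesis using that B(3) by (simp add: semi_one_def)
  qed
  moreover have "(\<Sum>k<n. B $$ (i, k) * A k j) = semi_one i j" if "i < n" "j < n" for i j
  proof -
    have "(B * ?A) $$ (i, j) = (\<Sum>k<n. B $$ (i, k) * A k j)"
      using that B(1) by (simp add: scalar_prod_def atLeast0LessThan)
    thus ?thesis using that B(2) by (simp add: semi_one_def)
  qed
  ultimately show ?thesis
    by (intro exI[of _ "\<lambda>i j. B $$ (i, j)"]) (simp add: block_inverse_def)
qed

lemma unit_lower_triangularD: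
  assumes "unit_lower_triangular A"
  shows "lower_triangular A" "A i i \<noteq> 0" "A i i = 1"
  using assms by (auto simp: unit_lower_triangular_def lower_triangular_def)

text \<open>
  Eliminating the inverse makes the condition on \<open>S1\<close> linear: \<open>semi_mult S1 g\<close> has to vanish below
  the diagonal.
\<close>

lemma is_LU_iff:
  "is_LU g S1 S2 \<longleftrightarrow>
     unit_lower_triangular S1 \<and> nonsingular_upper_triangular S2 \<and> S2 = semi_mult S1 g"
proof (cases "unit_lower_triangular S1")
  case True
  note S1 = unit_lower_triangularD[OF True]
  note inv = semi_inverse_lower[OF S1(1,2)]
  have "g = semi_mult (semi_inverse S1) S2 \<longleftrightarrow> S2 = semi_mult S1 g"
    using semi_mult_assoc_lower[OF S1(1) inv(1)] semi_mult_assoc_lower[OF inv(1) S1(1)]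
    by (metis inv(2,3) semi_mult_one_left)
  thus ?thesis by (auto simp: is_LU_def)
qed (simp add: is_LU_def)

text \<open>
  In row \<open>l\<close> the difference of two solutions is supported on indices below \<open>l\<close>, since both have the
  diagonal entry 1. It lies in the left kernel of the leading block of size \<open>l\<close> and is hence zero.
\<close>

lemma upper_unit_lower_unique:
  assumes blocks: "\<And>n. \<exists>B. block_inverse n g B"
    and S: "unit_lower_triangular S" "nonsingular_upper_triangular (semi_mult S g)"
    and T: "unit_lower_triangular T" "nonsingular_upper_triangular (semi_mult T g)"
  shows "S = T"
proof (intro ext)
  fix l i
  obtain B where B: "block_inverse l g B" using blocks by blast
  have ins: "{..l} = insert l {..<l}" by auto
  have "(\<Sum>k<l. (S l k - T l k) * g k j) = 0" if "j < l" for j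
  proof -
    have "semi_mult S g l j = 0" "semi_mult T g l j = 0"
      using S T that by (auto simp: nonsingular_upper_triangular_def)
    thus ?thesis
      using S T
      by (simp add: semi_mult_lower unit_lower_triangularD ins left_diff_distrib sum_subtractf
          add_eq_0_iff)
  qed
  hence "S l i = T l i" if "i < l"
    using block_left_kernel[OF B, of "\<lambda>k. S l k - T l k"] that by simp
  thus "S l i = T l i"
    using S(1) T(1) unfolding unit_lower_triangular_def by (metis linorder_neqE_nat)
qed

text \<open>
  Vanishing of row \<open>l\<close> of \<open>S g\<close> below the diagonal is a linear system for the entries of \<open>S\<close> left of
  the diagonal, whose matrix is the leading block of size \<open>l\<close>. If the diagonal entry of \<open>S g\<close> in that row
  vanished as well, the row of \<open>S\<close>, which contains a 1, would lie in the left kernel of the block of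
  size \<open>l + 1\<close>.
\<close>

lemma upper_unit_lower_exists:
  assumes blocks: "\<And>n. \<exists>B. block_inverse n g B"
  shows "\<exists>S. unit_lower_triangular S \<and> nonsingular_upper_triangular (semi_mult S g)"
proof -
  have "\<exists>v. \<forall>j<l. (\<Sum>k<l. v k * g k j) = - g l j" for l
  proof -
    obtain B where "block_inverse l g B" using blocks by blast
    from block_solve[OF this, of "\<lambda>j. - g l j"] show ?thesis .
  qed
  then obtain v where v: "\<And>l j. j < l \<Longrightarrow> (\<Sum>k<l. v l k * g k j) = - g l j"
    by metis
  define S where "S = (\<lambda>l k. if k < l then v l k else if k = l then 1 else 0)"
  have S: "unit_lower_triangular S"
    by (auto simp: unit_lower_triangular_def S_def)
  have upper: "semi_mult S g l j = 0" if "j < l" for l j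
  proof -
    have "{..l} = insert l {..<l}" by auto
    hence "semi_mult S g l j = S l l * g l j + (\<Sum>k<l. S l k * g k j)"
      using S by (simp add: semi_mult_lower unit_lower_triangularD)
    also have "(\<Sum>k<l. S l k * g k j) = (\<Sum>k<l. v l k * g k j)"
      by (simp add: S_def)
    finally show ?thesis using v that by (simp add: S_def)
  qed
  have "semi_mult S g l l \<noteq> 0" for l
  proof
    assume "semi_mult S g l l = 0"
    hence "semi_mult S g l j = 0" if "j < Suc l" for j
      using upper that less_Suc_eq by metis
    hence "(\<Sum>k<Suc l. S l k * g k j) = 0" if "j < Suc l" for j
      using that S by (simp only: semi_mult_lower unit_lower_triangularD lessThan_Suc_atMost)
    moreover obtain B where B: "block_inverse (Suc l) g B" using blocks by blast
    ultimately have "S l l = 0"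
      using block_left_kernel[OF B, of "S l" l] by simp
    thus False by (simp add: S_def)
  qed
  thus ?thesis
    using S upper by (auto simp: nonsingular_upper_triangular_def)
qed

lemma is_LU_cmv:
  assumes "\<And>n. \<exists>B. block_inverse n (cmv_moment \<mu>) B"
  shows "is_LU (cmv_moment \<mu>) (cmv_S1 \<mu>) (cmv_S2 \<mu>)"
proof -
  obtain S where S: "unit_lower_triangular S"
      "nonsingular_upper_triangular (semi_mult S (cmv_moment \<mu>))"
    using upper_unit_lower_exists[OF assms] by blast
  let ?U = "semi_mult S (cmv_moment \<mu>)"
  have LU: "is_LU (cmv_moment \<mu>) S ?U"
    using S by (simp add: is_LU_iff)
  have uniq: "S' = S \<and> U' = ?U" if "is_LU (cmv_moment \<mu>) S' U'" for S' U'
    using upper_unit_lower_unique[OF assms _ _ S, of S'] that by (auto simp: is_LU_iff)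
  have "cmv_S1 \<mu> = S" "cmv_S2 \<mu> = ?U"
    unfolding cmv_S1_def cmv_S2_def by (rule the_equality; use LU uniq in blast)+
  thus ?thesis using LU by simp
qed

section \<open>Moments on the unit circle\<close>

lemma space_borel_circle [simp]: "space borel_circle = sphere 0 1"
  by (simp add: borel_circle_def space_restrict_space)

lemma cnj_circle: "norm z = 1 \<Longrightarrow> cnj z = inverse z"
  using divide_conv_cnj[of z 1] by (simp add: divide_inverse)

lemma laurent_eval_superset:
  assumes "finite K" "Poly_Mapping.keys f \<subseteq> K"
  shows "laurent_eval f z = (\<Sum>k\<in>K. Poly_Mapping.lookup f k * z powi k)"
  unfolding laurent_eval_def
  by (rule sum.mono_neutral_left) (use assms in \<open>auto simp: in_keys_iff\<close>)

lemma laurent_eval_add: "laurent_eval (f + h) z = laurent_eval f z + laurent_eval h z"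
proof -
  let ?K = "Poly_Mapping.keys f \<union> Poly_Mapping.keys h"
  have "Poly_Mapping.keys (f + h) \<subseteq> ?K" by (rule Poly_Mapping.keys_add)
  thus ?thesis
    by (simp add: laurent_eval_superset[where K = ?K] lookup_add distrib_right sum.distrib)
qed

lemma laurent_eval_sum: "laurent_eval (sum f K) z = (\<Sum>k\<in>K. laurent_eval (f k) z)"
proof (induction K rule: infinite_finite_induct)
  case (insert x F)
  thus ?case by (simp add: laurent_eval_add)
qed (simp_all add: laurent_eval_def)

lemma laurent_eval_single: "laurent_eval (Poly_Mapping.single n c) z = c * z powi n"
  by (subst laurent_eval_superset[where K = "{n}"]) auto

lemma laurent_eval_apply_chi:
  assumes "\<And>k. n < k \<Longrightarrow> A l k = 0"
  shows "laurent_eval (apply_chi A l) z = (\<Sum>k\<le>n. A l k * z powi cmv_exponent k)"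
proof -
  have "apply_chi A l = Sum_any (\<lambda>k. Poly_Mapping.single (cmv_exponent k) (A l k))"
    by (simp add: apply_chi_def cmv_chi_def mult_single)
  also have "\<dots> = (\<Sum>k\<le>n. Poly_Mapping.single (cmv_exponent k) (A l k))"
  proof (rule Sum_any.expand_superset)
    show "{a. Poly_Mapping.single (cmv_exponent a) (A l a) \<noteq> 0} \<subseteq> {..n}"
      using assms by (fastforce intro: leI)
  qed simp
  finally show ?thesis
    by (simp add: laurent_eval_sum laurent_eval_single)
qed

lemma laurent_eval_bar_circle:
  assumes "norm z = 1"
  shows "laurent_eval (laurent_bar f) (inverse z) = cnj (laurent_eval f z)"
proof -
  have look: "Poly_Mapping.lookup (laurent_bar f) k = cnj (Poly_Mapping.lookup f k)" for k
    by (simp add: laurent_bar_def Poly_Mapping.map.rep_eq when_def)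
  hence "Poly_Mapping.keys (laurent_bar f) = Poly_Mapping.keys f"
    by (auto simp: in_keys_iff)
  thus ?thesis
    by (simp add: laurent_eval_def look cnj_circle[OF assms])
qed

lemma cmv_moment_eq:
  "cmv_moment \<mu> i j = circle_integral \<mu> (\<lambda>z. z powi (cmv_exponent i - cmv_exponent j))"
  unfolding cmv_moment_def
proof (rule complex_integral_cong)
  fix z :: complex assume "z \<in> space borel_circle"
  hence z: "norm z = 1" by simp
  hence "z \<noteq> 0" by auto
  thus "laurent_eval (cmv_chi i) z * cnj (laurent_eval (cmv_chi j) z) =
      z powi (cmv_exponent i - cmv_exponent j)"
    by (simp add: cmv_chi_def laurent_eval_single cnj_circle[OF z] power_int_inverse
        power_int_diff divide_inverse)
qed

text \<open>
  The exponents of the first \<open>n\<close> entries of \<open>\<chi>\<close> fill the integer interval that begins at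
  \<open>- (n div 2)\<close>; shifting it to begin at 0 gives a permutation of the indices below \<open>n\<close>.
\<close>

lemma cmv_exponent_bij:
  "bij_betw (\<lambda>i. nat (cmv_exponent i + int (n div 2))) {..<n} {..<n}"
proof -
  have nonneg: "0 \<le> cmv_exponent i + int (n div 2)" if "i < n" for i
    using that by (auto simp: cmv_exponent_def elim!: oddE)
  have "inj_on (\<lambda>i. nat (cmv_exponent i + int (n div 2))) {..<n}"
  proof (rule inj_onI)
    fix i j assume "i \<in> {..<n}" "j \<in> {..<n}"
      "nat (cmv_exponent i + int (n div 2)) = nat (cmv_exponent j + int (n div 2))"
    hence "cmv_exponent i = cmv_exponent j" using nonneg by (auto simp: nat_eq_iff)
    thus "i = j" by (auto simp: cmv_exponent_def split: if_splits elim!: evenE oddE)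
  qed
  moreover have "nat (cmv_exponent i + int (n div 2)) < n" if "i < n" for i
    using that by (auto simp: cmv_exponent_def)
  ultimately show ?thesis
    by (intro bij_betw_imageI endo_inj_surj) auto
qed

text \<open>
  The entries of the moment matrix and of the Toeplitz matrices depend only on the difference of two
  exponents, which is unaffected by the shift in \<open>cmv_exponent_bij\<close>.
\<close>

lemma cmv_blocks_invertible:
  assumes "quasi_definite \<mu>"
  shows "\<exists>B. block_inverse n (cmv_moment \<mu>) B"
proof (cases n)
  case 0
  thus ?thesis by (simp add: block_inverse_def)
next
  case (Suc m)
  let ?T = "\<lambda>i j. circle_integral \<mu> (\<lambda>z. z powi (int i - int j))"
  let ?p = "\<lambda>i. nat (cmv_exponent i + int (n div 2))"
  obtain B where B: "block_inverse n ?T B"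
    using det_nonzero_block_inverse[of n ?T] assms Suc by (auto simp: quasi_definite_def)
  have p: "int (?p i) = cmv_exponent i + int (n div 2)" if "i < n" for i
    using that by (auto simp: cmv_exponent_def elim!: oddE)
  have "?T (?p i) (?p j) = cmv_moment \<mu> i j" if "i < n" "j < n" for i j
    unfolding p[OF that(1)] p[OF that(2)] cmv_moment_eq by simp
  hence "block_inverse n (cmv_moment \<mu>) (\<lambda>i j. B (?p i) (?p j))"
    using block_inverse_reindex[OF B cmv_exponent_bij] by (simp add: block_inverse_def)
  thus ?thesis by blast
qed

lemma circle_integral_laurent:
  assumes \<mu>: "complex_measure borel_circle \<mu>"
  shows "circle_integral \<mu> (\<lambda>z. \<Sum>i\<in>I. c i * z powi e i) =
         (\<Sum>i\<in>I. c i * circle_integral \<mu> (\<lambda>z. z powi e i))"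
proof (rule complex_integral_linear[OF \<mu>, where K = 1])
  fix i
  have "continuous_on (sphere 0 1) (\<lambda>z::complex. z powi e i)"
    by (intro continuous_intros) auto
  thus "(\<lambda>z. z powi e i) \<in> borel_measurable borel_circle"
    unfolding borel_circle_def by (rule borel_measurable_continuous_on_restrict)
qed (simp add: norm_power_int)

theorem theorem1:
  fixes \<mu> :: "complex set \<Rightarrow> complex" and l k :: nat
  assumes "complex_measure borel_circle \<mu>"
    and "quasi_definite \<mu>"
  shows "circle_integral \<mu>
           (\<lambda>z. laurent_eval (cmv_phi1 \<mu> l) z * laurent_eval (laurent_bar (cmv_phi2 \<mu> k)) (inverse z))
         = (if l = k then 1 else 0)"
proof -
  let ?g = "cmv_moment \<mu>"
  let ?S = "cmv_S1 \<mu>" and ?R = "semi_inverse (cmv_S2 \<mu>)"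
  let ?e = cmv_exponent
  have LU: "unit_lower_triangular ?S" "nonsingular_upper_triangular (cmv_S2 \<mu>)"
      "cmv_S2 \<mu> = semi_mult ?S ?g"
    using is_LU_cmv[OF cmv_blocks_invertible[OF assms(2)]] unfolding is_LU_iff by blast+
  note R = semi_inverse_upper[OF LU(2)]
  have "laurent_eval (cmv_phi1 \<mu> l) z * laurent_eval (laurent_bar (cmv_phi2 \<mu> k)) (inverse z) =
      (\<Sum>(i, j)\<in>{..l} \<times> {..k}. (?S l i * ?R j k) * z powi (?e i - ?e j))"
    if z: "norm z = 1" for z
  proof -
    have "z \<noteq> 0" using z by auto
    have phi1: "laurent_eval (cmv_phi1 \<mu> l) z = (\<Sum>i\<le>l. ?S l i * z powi ?e i)"
      unfolding cmv_phi1_def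
      by (rule laurent_eval_apply_chi) (use LU(1) in \<open>simp add: unit_lower_triangular_def\<close>)
    have phi2: "laurent_eval (cmv_phi2 \<mu> k) z = (\<Sum>j\<le>k. cnj (?R j k) * z powi ?e j)"
      unfolding cmv_phi2_def
      by (subst laurent_eval_apply_chi[where n = k]) (simp_all add: semi_adjoint_def R)
    show ?thesis
      unfolding phi1 laurent_eval_bar_circle[OF z] phi2 sum.cartesian_product[symmetric]
      by (simp add: cnj_circle[OF z] sum_product power_int_inverse power_int_diff divide_inverse
          \<open>z \<noteq> 0\<close> mult_ac)
  qed
  hence "circle_integral \<mu> (\<lambda>z. laurent_eval (cmv_phi1 \<mu> l) z *
        laurent_eval (laurent_bar (cmv_phi2 \<mu> k)) (inverse z)) =
      circle_integral \<mu> (\<lambda>z. \<Sum>p\<in>{..l} \<times> {..k}.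
        (?S l (fst p) * ?R (snd p) k) * z powi (?e (fst p) - ?e (snd p)))"
    by (intro complex_integral_cong) (simp add: case_prod_beta)
  also have "\<dots> = (\<Sum>p\<in>{..l} \<times> {..k}. (?S l (fst p) * ?R (snd p) k) * ?g (fst p) (snd p))"
    by (simp add: circle_integral_laurent[OF assms(1)] cmv_moment_eq)
  also have "\<dots> = (\<Sum>i\<le>l. \<Sum>j\<le>k. (?S l i * ?R j k) * ?g i j)"
    by (simp add: sum.cartesian_product case_prod_beta)
  also have "\<dots> = (\<Sum>j\<le>k. (\<Sum>i\<le>l. ?S l i * ?g i j) * ?R j k)"
    unfolding sum_distrib_right by (subst sum.swap) (simp add: mult_ac)
  also have "\<dots> = (\<Sum>j\<le>k. cmv_S2 \<mu> l j * ?R j k)"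
    unfolding LU(3) by (simp add: semi_mult_lower unit_lower_triangularD[OF LU(1)])
  also have "\<dots> = semi_mult (cmv_S2 \<mu>) ?R l k"
    by (rule semi_mult_finite[symmetric]) (auto simp: R)
  also have "\<dots> = (if l = k then 1 else 0)"
    by (simp add: R semi_one_def)
  finally show ?thesis .
qed

end
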